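(* Let $\alpha,\beta,\gamma$ be constants with $\alpha+\beta+\gamma=0$, $\alpha\beta\gamma\neq0$, and put $b=(\beta-\gamma)/\alpha$. Consider, for functions $u,v$ of $(t,x,y,z)$ with $u_{yz}\neq0$, the two-component general heavenly system $$u_t=v,\qquad v_t=\frac{1}{u_{yz}}\bigl[u_{xx}u_{yz}-u_{xy}u_{xz}+v_yv_z+b(v_yu_{xz}-v_zu_{xy})\bigr].$$ Put $w=u_{yz}D_x-u_{xz}D_y$ and $\zeta=u_{yz}D_x-u_{xy}D_z$. Then the matrix operator $R$ with entries $$\begin{aligned} R_{11}&=w^{-1}(b\zeta+v_yD_z),\qquad R_{12}=-w^{-1}u_{yz},\\ R_{21}&=\frac1{u_{yz}}\bigl(v_zD_yw^{-1}v_yD_z-\zeta\bigr)+\frac b{u_{yz}}\bigl(v_zD_yw^{-1}\zeta-v_yD_z\bigr),\\ R_{22}&=b-\frac{v_z}{u_{yz}}D_yw^{-1}u_{yz} \end{aligned}$$ is a recursion operator for symmetries of the system: if $(\varphi,\psi)$ is a symmetry characteristic of the system and $(\tilde\varphi,\tilde\psi)^T=R(\varphi,\psi)^T$ with $\tilde\varphi_t=\tilde\psi$, then $(\tilde\varphi,\tilde\psi)$ is also a symmetry characteristic of the system.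
   Context: Letter subscripts are partial derivatives and $D_x,D_y,D_z$ total derivatives; products of operators are compositions. Everything is evaluated on a solution $(u,v)$. A pair $(\varphi,\psi)$ is a symmetry characteristic if it satisfies the linearization of the system on solutions; in particular $\psi=\varphi_t$. The operator $w^{-1}$ is an inverse of $w$, which is determined up to adding elements of $\ker w$; explicitly, $(\tilde\varphi,\tilde\psi)^T=R(\varphi,\psi)^T$ means $$w\tilde\varphi=b\,\zeta\varphi+v_y\varphi_z-u_{yz}\psi,\qquad u_{yz}\tilde\psi=v_z\tilde\varphi_y-\zeta\varphi-b\,v_y\varphi_z+b\,u_{yz}\psi .$$ The system is the two-component form of $\alpha u_{12}u_{34}+\beta u_{13}u_{24}+\gamma u_{14}u_{23}=0$ under $t=z_1+z_2$, $x=z_1-z_2$, $y=z_3$, $z=z_4$, $v=u_t$. *)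

theory Defs
  imports "HOL-Analysis.Analysis"
begin

text \<open>
  Points of the space of independent variables are vectors in \<open>real ^ 4\<close> with coordinates
  \<open>(t, x, y, z)\<close> numbered 1, 2, 3, 4. Functions are total on \<open>real ^ 4\<close>, but only their
  values on an open domain \<open>\<Omega>\<close> matter.
\<close>

type_synonym scalar_fun = "real ^ 4 \<Rightarrow> real"

definition pd :: "4 \<Rightarrow> scalar_fun \<Rightarrow> scalar_fun" where
  "pd i f = (\<lambda>p. frechet_derivative f (at p) (axis i 1))"

abbreviation Dt :: "scalar_fun \<Rightarrow> scalar_fun" where "Dt \<equiv> pd 1"
abbreviation Dx :: "scalar_fun \<Rightarrow> scalar_fun" where "Dx \<equiv> pd 2"
abbreviation Dy :: "scalar_fun \<Rightarrow> scalar_fun" where "Dy \<equiv> pd 3"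
abbreviation Dz :: "scalar_fun \<Rightarrow> scalar_fun" where "Dz \<equiv> pd 4"

primrec Ck_on :: "nat \<Rightarrow> (real ^ 4) set \<Rightarrow> scalar_fun \<Rightarrow> bool" where
  "Ck_on 0 \<Omega> f \<longleftrightarrow> continuous_on \<Omega> f"
| "Ck_on (Suc k) \<Omega> f \<longleftrightarrow> f differentiable_on \<Omega> \<and> (\<forall>i. Ck_on k \<Omega> (pd i f))"

text \<open>Meant for open \<open>\<Omega>\<close> only, since \<open>pd\<close> uses full neighbourhoods.\<close>

definition smooth_on :: "(real ^ 4) set \<Rightarrow> scalar_fun \<Rightarrow> bool" where
  "smooth_on \<Omega> f \<longleftrightarrow> (\<forall>k. Ck_on k \<Omega> f)"

text \<open>The two equations of the system, each written as left-hand side minus right-hand side.\<close>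

definition heavenly1 :: "scalar_fun \<Rightarrow> scalar_fun \<Rightarrow> scalar_fun" where
  "heavenly1 u v = (\<lambda>p. Dt u p - v p)"

definition heavenly2 :: "real \<Rightarrow> scalar_fun \<Rightarrow> scalar_fun \<Rightarrow> scalar_fun" where
  "heavenly2 b u v = (\<lambda>p. Dt v p - 1 / Dz (Dy u) p *
      (Dx (Dx u) p * Dz (Dy u) p - Dy (Dx u) p * Dz (Dx u) p + Dy v p * Dz v p
       + b * (Dy v p * Dz (Dx u) p - Dz v p * Dy (Dx u) p)))"

definition heavenly_solution ::
    "(real ^ 4) set \<Rightarrow> real \<Rightarrow> scalar_fun \<Rightarrow> scalar_fun \<Rightarrow> bool" where
  "heavenly_solution \<Omega> b u v \<longleftrightarrow>
     (\<forall>p\<in>\<Omega>. Dz (Dy u) p \<noteq> 0 \<and> heavenly1 u v p = 0 \<and> heavenly2 b u v p = 0)"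

text \<open>
  The linearization of an equation \<open>F(u, v) = 0\<close> at \<open>(u, v)\<close> in the direction
  \<open>(\<phi>, \<psi>)\<close> is \<open>d/d\<epsilon> F(u + \<epsilon>\<phi>, v + \<epsilon>\<psi>) = 0\<close> at \<open>\<epsilon> = 0\<close>.
\<close>

definition satisfies_linearization ::
    "(real ^ 4) set \<Rightarrow> (scalar_fun \<Rightarrow> scalar_fun \<Rightarrow> scalar_fun) \<Rightarrow>
     scalar_fun \<Rightarrow> scalar_fun \<Rightarrow> scalar_fun \<Rightarrow> scalar_fun \<Rightarrow> bool" where
  "satisfies_linearization \<Omega> F u v \<phi> \<psi> \<longleftrightarrow>
     (\<forall>p\<in>\<Omega>. ((\<lambda>\<epsilon>. F (\<lambda>q. u q + \<epsilon> * \<phi> q) (\<lambda>q. v q + \<epsilon> * \<psi> q) p)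
               has_real_derivative 0) (at 0))"

definition symmetry_characteristic ::
    "(real ^ 4) set \<Rightarrow> real \<Rightarrow> scalar_fun \<Rightarrow> scalar_fun \<Rightarrow> scalar_fun \<Rightarrow> scalar_fun \<Rightarrow> bool" where
  "symmetry_characteristic \<Omega> b u v \<phi> \<psi> \<longleftrightarrow>
     satisfies_linearization \<Omega> heavenly1 u v \<phi> \<psi> \<and>
     satisfies_linearization \<Omega> (heavenly2 b) u v \<phi> \<psi>"

definition w_op :: "scalar_fun \<Rightarrow> scalar_fun \<Rightarrow> scalar_fun" where
  "w_op u f = (\<lambda>p. Dz (Dy u) p * Dx f p - Dz (Dx u) p * Dy f p)"

definition zeta_op :: "scalar_fun \<Rightarrow> scalar_fun \<Rightarrow> scalar_fun" where
  "zeta_op u f = (\<lambda>p. Dz (Dy u) p * Dx f p - Dy (Dx u) p * Dz f p)"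

text \<open>
  \<open>(\<phi>', \<psi>')\<^sup>T = R (\<phi>, \<psi>)\<^sup>T\<close>. Since \<open>w\<inverse>\<close> is determined only up to \<open>ker w\<close>,
  this is a relation and not a function. The same value \<open>\<phi>'\<close> of \<open>w\<inverse>\<close> enters both rows.
\<close>

definition recursion_image ::
    "(real ^ 4) set \<Rightarrow> real \<Rightarrow> scalar_fun \<Rightarrow> scalar_fun \<Rightarrow> scalar_fun \<Rightarrow> scalar_fun \<Rightarrow>
     scalar_fun \<Rightarrow> scalar_fun \<Rightarrow> bool" where
  "recursion_image \<Omega> b u v \<phi> \<psi> \<phi>' \<psi>' \<longleftrightarrow> (\<forall>p\<in>\<Omega>.
     w_op u \<phi>' p = b * zeta_op u \<phi> p + Dy v p * Dz \<phi> p - Dz (Dy u) p * \<psi> p \<and>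
     Dz (Dy u) p * \<psi>' p
       = Dz v p * Dy \<phi>' p - zeta_op u \<phi> p - b * Dy v p * Dz \<phi> p + b * Dz (Dy u) p * \<psi> p)"

text \<open>
  The entries of the matrix operator \<open>R\<close> for a chosen branch \<open>W\<close> of \<open>w\<inverse>\<close>. The lemma
  below shows that, for every linear branch defined on the functions involved, applying the
  matrix yields a pair in the relation above. The relation does not presuppose that such a
  branch exists.
\<close>

definition R11 :: "(scalar_fun \<Rightarrow> scalar_fun) \<Rightarrow> real \<Rightarrow> scalar_fun \<Rightarrow> scalar_fun \<Rightarrow> scalar_fun \<Rightarrow> scalar_fun" where
  "R11 W b u v f = W (\<lambda>p. b * zeta_op u f p + Dy v p * Dz f p)"

definition R12 :: "(scalar_fun \<Rightarrow> scalar_fun) \<Rightarrow> scalar_fun \<Rightarrow> scalar_fun \<Rightarrow> scalar_fun" where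
  "R12 W u f = (\<lambda>p. - W (\<lambda>q. Dz (Dy u) q * f q) p)"

definition R21 :: "(scalar_fun \<Rightarrow> scalar_fun) \<Rightarrow> real \<Rightarrow> scalar_fun \<Rightarrow> scalar_fun \<Rightarrow> scalar_fun \<Rightarrow> scalar_fun" where
  "R21 W b u v f = (\<lambda>p.
     1 / Dz (Dy u) p * (Dz v p * Dy (W (\<lambda>q. Dy v q * Dz f q)) p - zeta_op u f p)
     + b / Dz (Dy u) p * (Dz v p * Dy (W (zeta_op u f)) p - Dy v p * Dz f p))"

definition R22 :: "(scalar_fun \<Rightarrow> scalar_fun) \<Rightarrow> real \<Rightarrow> scalar_fun \<Rightarrow> scalar_fun \<Rightarrow> scalar_fun \<Rightarrow> scalar_fun" where
  "R22 W b u v f = (\<lambda>p. b * f p - Dz v p / Dz (Dy u) p * Dy (W (\<lambda>q. Dz (Dy u) q * f q)) p)"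

lemma pd_lin:
  assumes "f differentiable at p" "g differentiable at p"
  shows "pd i (\<lambda>q. c * f q + d * g q) p = c * pd i f p + d * pd i g p"
proof -
  have "((\<lambda>q. c * f q + d * g q) has_derivative
      (\<lambda>h. c * frechet_derivative f (at p) h + d * frechet_derivative g (at p) h)) (at p)"
    using assms by (intro has_derivative_add has_derivative_mult_right)
      (simp_all only: frechet_derivative_works)
  from frechet_derivative_at[OF this, symmetric] show ?thesis
    unfolding pd_def by (rule fun_cong)
qed

lemma recursion_matrix_row2:
  fixes n :: real
  assumes "n \<noteq> 0"
  shows "n * (1 / n * (vz * V - Z) + b / n * (vz * Zy - vy * f) + (b * q - vz / n * U))
    = vz * (b * Zy + V - U) - Z - b * vy * f + b * n * q"
proof -
  have "n * (1 / n * (vz * V - Z) + b / n * (vz * Zy - vy * f) + (b * q - vz / n * U))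
    = (n / n) * (vz * V - Z) + (n / n) * (b * (vz * Zy - vy * f)) + n * b * q - (n / n) * (vz * U)"
    by (simp only: times_divide_eq_left times_divide_eq_right distrib_left right_diff_distrib
        mult_1 mult.assoc mult.commute mult.left_commute add_diff_eq)
  then show ?thesis using assms by (simp add: algebra_simps)
qed

lemma recursion_image_matrix:
  fixes W :: "scalar_fun \<Rightarrow> scalar_fun" and S :: "scalar_fun set"
  assumes nz: "\<And>p. p \<in> \<Omega> \<Longrightarrow> Dz (Dy u) p \<noteq> 0"
    and diff: "\<And>f p. f \<in> S \<Longrightarrow> p \<in> \<Omega> \<Longrightarrow> W f differentiable at p"
    and inv: "\<And>f p. f \<in> S \<Longrightarrow> p \<in> \<Omega> \<Longrightarrow> w_op u (W f) p = f p"
    and lin: "\<And>f g c d. f \<in> S \<Longrightarrow> g \<in> S \<Longrightarrow>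
        (\<lambda>p. c * f p + d * g p) \<in> S \<and> W (\<lambda>p. c * f p + d * g p) = (\<lambda>p. c * W f p + d * W g p)"
    and S: "zeta_op u \<phi> \<in> S" "(\<lambda>p. Dy v p * Dz \<phi> p) \<in> S" "(\<lambda>p. Dz (Dy u) p * \<psi> p) \<in> S"
  shows "recursion_image \<Omega> b u v \<phi> \<psi>
     (\<lambda>p. R11 W b u v \<phi> p + R12 W u \<psi> p) (\<lambda>p. R21 W b u v \<phi> p + R22 W b u v \<psi> p)"
proof -
  define Z where "Z = zeta_op u \<phi>"
  define V where "V = (\<lambda>p. Dy v p * Dz \<phi> p)"
  define U where "U = (\<lambda>p. Dz (Dy u) p * \<psi> p)"
  define A where "A = (\<lambda>p. b * Z p + 1 * V p)"
  have ZS: "Z \<in> S" and VS: "V \<in> S" and US: "U \<in> S"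
    using S by (simp_all add: Z_def V_def U_def)
  have AS: "A \<in> S" and WA: "W A = (\<lambda>p. b * W Z p + 1 * W V p)"
    using lin[OF ZS VS, of b 1] by (simp_all add: A_def)
  have phi: "(\<lambda>p. R11 W b u v \<phi> p + R12 W u \<psi> p) = (\<lambda>p. 1 * W A p + (-1) * W U p)"
    by (simp add: R11_def R12_def A_def Z_def V_def U_def)
  have d: "pd i (\<lambda>p. 1 * W A p + (-1) * W U p) p = pd i (W A) p - pd i (W U) p"
    if "p \<in> \<Omega>" for i p
    using pd_lin[OF diff[OF AS that] diff[OF US that], of i 1 "-1"] by simp
  have dA: "pd i (W A) p = b * pd i (W Z) p + pd i (W V) p" if "p \<in> \<Omega>" for i p
    using pd_lin[OF diff[OF ZS that] diff[OF VS that], of i b 1] by (simp add: WA)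
  show ?thesis
    unfolding recursion_image_def phi
  proof (intro ballI conjI)
    fix p assume p: "p \<in> \<Omega>"
    have "w_op u (\<lambda>p. 1 * W A p + (-1) * W U p) p = w_op u (W A) p - w_op u (W U) p"
      unfolding w_op_def d[OF p] by (simp add: algebra_simps)
    also have "\<dots> = A p - U p"
      by (simp add: inv[OF AS p] inv[OF US p])
    finally show "w_op u (\<lambda>p. 1 * W A p + (-1) * W U p) p
        = b * zeta_op u \<phi> p + Dy v p * Dz \<phi> p - Dz (Dy u) p * \<psi> p"
      by (simp only: A_def Z_def V_def U_def mult_1)
    have row: "R21 W b u v \<phi> p + R22 W b u v \<psi> p =
        1 / Dz (Dy u) p * (Dz v p * Dy (W V) p - Z p)
        + b / Dz (Dy u) p * (Dz v p * Dy (W Z) p - Dy v p * Dz \<phi> p)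
        + (b * \<psi> p - Dz v p / Dz (Dy u) p * Dy (W U) p)"
      by (simp only: R21_def R22_def Z_def V_def U_def)
    show "Dz (Dy u) p * (R21 W b u v \<phi> p + R22 W b u v \<psi> p)
        = Dz v p * Dy (\<lambda>p. 1 * W A p + (-1) * W U p) p - zeta_op u \<phi> p
          - b * Dy v p * Dz \<phi> p + b * Dz (Dy u) p * \<psi> p"
      unfolding row d[OF p] dA[OF p] Z_def[symmetric]
      by (rule recursion_matrix_row2[OF nz[OF p]])
  qed
qed

end

theory Submission
  imports Defs
begin

text \<open>
  Besides \<open>w\<close> and \<open>\<zeta>\<close> put \<open>A = u\<^sub>y\<^sub>z D\<^sub>t - v\<^sub>z D\<^sub>y\<close> and
  \<open>B = u\<^sub>y\<^sub>z D\<^sub>t - v\<^sub>y D\<^sub>z\<close>. As \<open>\<psi> = \<phi>\<^sub>t\<close> and \<open>\<psi>' = \<phi>'\<^sub>t\<close>, the recursion reads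
  \<open>w \<phi>' = b \<zeta> \<phi> - B \<phi>\<close> and \<open>A \<phi>' = b B \<phi> - \<zeta> \<phi>\<close>, that is,
  \<open>(w + b A) \<phi>' = (b\<^sup>2 - 1) B \<phi>\<close> and \<open>(A + b w) \<phi>' = (b\<^sup>2 - 1) \<zeta> \<phi>\<close>.
  On solutions, the linearized second equation for \<open>\<phi>'\<close>, multiplied by \<open>u\<^sub>y\<^sub>z\<close>, has the same
  second-order part as \<open>B (A + b w) \<phi>' - \<zeta> (w + b A) \<phi>' = (b\<^sup>2 - 1) [B, \<zeta>] \<phi>\<close>. The
  remaining terms have first order and cancel by the \<open>z\<close>-derivative of the second equation.
\<close>

section \<open>Calculus of partial derivatives\<close>

lemma smooth_on_pd: "smooth_on \<Omega> f \<Longrightarrow> smooth_on \<Omega> (pd i f)"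
  unfolding smooth_on_def by (metis Ck_on.simps(2))

lemma smooth_on_continuous: "smooth_on \<Omega> f \<Longrightarrow> continuous_on \<Omega> f"
  unfolding smooth_on_def by (metis Ck_on.simps(1))

lemma smooth_on_differentiable:
  assumes "smooth_on \<Omega> f" "open \<Omega>" "p \<in> \<Omega>"
  shows "f differentiable at p"
  using assms unfolding smooth_on_def
  by (metis Ck_on.simps(2) differentiable_on_eq_differentiable_at)

text \<open>Since \<Omega> is open, \<open>f\<close> and \<open>g\<close> agree near
  \<open>p\<close> and have the same derivatives there, so the choice inside
  \<open>frechet_derivative\<close> agrees even where none exists. Equations valid on \<Omega> can
  therefore be differentiated.\<close>

lemma pd_cong:
  assumes "open \<Omega>" "p \<in> \<Omega>" "\<forall>q\<in>\<Omega>. f q = g q"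
  shows "pd i f p = pd i g p"
proof -
  have "(f has_derivative D) (at p) \<longleftrightarrow> (g has_derivative D) (at p)" for D
    using has_derivative_transform_within_open[OF _ assms(1,2), of _ D _ g]
      has_derivative_transform_within_open[OF _ assms(1,2), of _ D _ f] assms(3) by auto
  then show ?thesis by (simp add: pd_def frechet_derivative_def)
qed

lemma pd_add:
  assumes "f differentiable at p" "g differentiable at p"
  shows "pd i (\<lambda>q. f q + g q) p = pd i f p + pd i g p"
  using pd_lin[OF assms, of i 1 1] by simp

lemma pd_diff:
  assumes "f differentiable at p" "g differentiable at p"
  shows "pd i (\<lambda>q. f q - g q) p = pd i f p - pd i g p"
  using pd_lin[OF assms, of i 1 "-1"] by simp

lemma pd_mult:
  assumes "f differentiable at p" "g differentiable at p"
  shows "pd i (\<lambda>q. f q * g q) p = f p * pd i g p + pd i f p * g p"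
proof -
  have "((\<lambda>q. f q * g q) has_derivative
      (\<lambda>h. f p * frechet_derivative g (at p) h + frechet_derivative f (at p) h * g p)) (at p)"
    using assms by (intro has_derivative_mult) (simp_all only: frechet_derivative_works)
  from frechet_derivative_at[OF this, symmetric] show ?thesis
    unfolding pd_def by (rule fun_cong)
qed

lemma pd_const: "pd i (\<lambda>q. c) p = 0"
  by (simp add: pd_def)

lemma has_real_derivative_along_axis:
  assumes "f differentiable at (q + r *\<^sub>R axis i 1)"
  shows "((\<lambda>s. f (q + s *\<^sub>R axis i 1)) has_real_derivative pd i f (q + r *\<^sub>R axis i 1)) (at r)"
proof -
  let ?D = "frechet_derivative f (at (q + r *\<^sub>R axis i 1))"
  have D: "(f has_derivative ?D) (at (q + r *\<^sub>R axis i 1))"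
    using assms by (simp only: frechet_derivative_works)
  have "((\<lambda>s. q + s *\<^sub>R axis i 1) has_derivative (\<lambda>h. h *\<^sub>R axis i 1)) (at r)"
    by (auto intro!: derivative_eq_intros)
  from has_derivative_compose[OF this D]
  have "((\<lambda>s. f (q + s *\<^sub>R axis i 1)) has_derivative (\<lambda>h. ?D (h *\<^sub>R axis i 1))) (at r)" .
  moreover have "?D (h *\<^sub>R axis i 1) = pd i f (q + r *\<^sub>R axis i 1) * h" for h
    using linear_cmul[OF has_derivative_linear[OF D]] by (simp add: pd_def)
  ultimately show ?thesis
    by (simp add: has_field_derivative_def)
qed

text \<open>The mean value theorem is applied twice: in direction \<open>i\<close> to an increment
  of \<open>f\<close> along \<open>j\<close>, then in direction \<open>j\<close> to
  \<open>pd i f\<close>. Both increments stay below \<open>s\<close>, whence the radius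
  \<open>2 * s\<close>.\<close>

lemma second_difference_mean_value:
  assumes sub: "ball p (2 * s) \<subseteq> \<Omega>" and s: "0 < s" and \<Omega>: "open \<Omega>"
    and f: "smooth_on \<Omega> f" and t: "0 < t" "t < s"
  obtains q where "dist p q < 2 * s"
    "f (p + t *\<^sub>R axis i 1 + t *\<^sub>R axis j 1) - f (p + t *\<^sub>R axis i 1)
      - f (p + t *\<^sub>R axis j 1) + f p = t\<^sup>2 * pd j (pd i f) q"
proof -
  have near: "dist p (p + a *\<^sub>R axis i 1 + c *\<^sub>R axis j 1) < 2 * s"
    if "0 \<le> a" "a \<le> t" "0 \<le> c" "c \<le> t" for a c
  proof -
    have "norm (a *\<^sub>R (axis i 1 :: real^4) + c *\<^sub>R axis j 1) \<le> \<bar>a\<bar> + \<bar>c\<bar>"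
      by (rule order_trans[OF norm_triangle_ineq]) (simp add: norm_axis_1)
    also have "\<dots> < 2 * s" using that t by simp
    also have "a *\<^sub>R (axis i 1 :: real^4) + c *\<^sub>R axis j 1 = p + a *\<^sub>R axis i 1 + c *\<^sub>R axis j 1 - p"
      by simp
    finally show ?thesis by (simp only: dist_norm norm_minus_commute)
  qed
  then have inside: "p + a *\<^sub>R axis i 1 + c *\<^sub>R axis j 1 \<in> \<Omega>"
    if "0 \<le> a" "a \<le> t" "0 \<le> c" "c \<le> t" for a c
    using that sub by (meson mem_ball subsetD)
  have along_i: "((\<lambda>a. f (p + a *\<^sub>R axis i 1 + c *\<^sub>R axis j 1)) has_real_derivative
      pd i f (p + a *\<^sub>R axis i 1 + c *\<^sub>R axis j 1)) (at a)"
    if "0 \<le> a" "a \<le> t" "0 \<le> c" "c \<le> t" for a c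
  proof -
    \<comment> \<open>The derivative along an axis is available only for the increment added
      last.\<close>
    have swap: "p + r *\<^sub>R axis i 1 + c *\<^sub>R axis j 1 = p + c *\<^sub>R axis j 1 + r *\<^sub>R axis i 1" for r
      by (simp only: add.assoc add.commute[of "r *\<^sub>R _"])
    show ?thesis
      unfolding swap by (rule has_real_derivative_along_axis
        [OF smooth_on_differentiable[OF f \<Omega> inside[OF that], unfolded swap]])
  qed
  have along_j: "((\<lambda>c. pd i f (p + a *\<^sub>R axis i 1 + c *\<^sub>R axis j 1)) has_real_derivative
      pd j (pd i f) (p + a *\<^sub>R axis i 1 + c *\<^sub>R axis j 1)) (at c)"
    if "0 \<le> a" "a \<le> t" "0 \<le> c" "c \<le> t" for a c
    by (rule has_real_derivative_along_axis
        [OF smooth_on_differentiable[OF smooth_on_pd[OF f] \<Omega> inside[OF that]]])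
  \<comment> \<open>\<open>g t - g 0\<close> is the second difference.\<close>
  define g where "g = (\<lambda>a. f (p + a *\<^sub>R axis i 1 + t *\<^sub>R axis j 1) - f (p + a *\<^sub>R axis i 1))"
  have "\<And>a. 0 \<le> a \<Longrightarrow> a \<le> t \<Longrightarrow> (g has_real_derivative
      (pd i f (p + a *\<^sub>R axis i 1 + t *\<^sub>R axis j 1) - pd i f (p + a *\<^sub>R axis i 1))) (at a)"
    using DERIV_diff[OF along_i[where c = t] along_i[where c = 0]] t by (simp add: g_def)
  from MVT2[OF t(1) this] obtain a where a: "0 < a" "a < t"
    and g: "g t - g 0 = t * (pd i f (p + a *\<^sub>R axis i 1 + t *\<^sub>R axis j 1) - pd i f (p + a *\<^sub>R axis i 1))"
    by auto
  have "\<And>c. 0 \<le> c \<Longrightarrow> c \<le> t \<Longrightarrow>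
      ((\<lambda>c. pd i f (p + a *\<^sub>R axis i 1 + c *\<^sub>R axis j 1)) has_real_derivative
      pd j (pd i f) (p + a *\<^sub>R axis i 1 + c *\<^sub>R axis j 1)) (at c)"
    using along_j a by simp
  from MVT2[OF t(1) this] obtain c where c: "0 < c" "c < t"
    and "pd i f (p + a *\<^sub>R axis i 1 + t *\<^sub>R axis j 1) - pd i f (p + a *\<^sub>R axis i 1)
      = t * pd j (pd i f) (p + a *\<^sub>R axis i 1 + c *\<^sub>R axis j 1)"
    by auto
  with g have "g t - g 0 = t\<^sup>2 * pd j (pd i f) (p + a *\<^sub>R axis i 1 + c *\<^sub>R axis j 1)"
    by (simp add: power2_eq_square)
  then have "f (p + t *\<^sub>R axis i 1 + t *\<^sub>R axis j 1) - f (p + t *\<^sub>R axis i 1)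
      - f (p + t *\<^sub>R axis j 1) + f p = t\<^sup>2 * pd j (pd i f) (p + a *\<^sub>R axis i 1 + c *\<^sub>R axis j 1)"
    by (simp add: g_def)
  moreover have "dist p (p + a *\<^sub>R axis i 1 + c *\<^sub>R axis j 1) < 2 * s"
    using a c by (intro near) simp_all
  ultimately show ?thesis by (rule that[rotated])
qed

text \<open>The second difference is symmetric in \<open>i\<close> and \<open>j\<close>, so the two
  mixed derivatives coincide at two possibly different points near \<open>p\<close>; continuity of
  both carries the equality to \<open>p\<close>.\<close>

lemma pd_commute:
  assumes f: "smooth_on \<Omega> f" and \<Omega>: "open \<Omega>" and p: "p \<in> \<Omega>"
  shows "pd i (pd j f) p = pd j (pd i f) p"
proof -
  have "\<bar>pd i (pd j f) p - pd j (pd i f) p\<bar> < e" if "0 < e" for e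
  proof -
    have cont: "isCont (pd k (pd l f)) p" for k l
      using smooth_on_continuous[OF smooth_on_pd[OF smooth_on_pd[OF f]]] \<Omega> p
      by (simp add: continuous_on_eq_continuous_at)
    obtain d1 where d1: "d1 > 0"
      "\<And>q. dist q p < d1 \<Longrightarrow> dist (pd i (pd j f) q) (pd i (pd j f) p) < e / 2"
      using cont[of i j] \<open>0 < e\<close> unfolding continuous_at_eps_delta
      by (meson half_gt_zero)
    obtain d2 where d2: "d2 > 0"
      "\<And>q. dist q p < d2 \<Longrightarrow> dist (pd j (pd i f) q) (pd j (pd i f) p) < e / 2"
      using cont[of j i] \<open>0 < e\<close> unfolding continuous_at_eps_delta
      by (meson half_gt_zero)
    obtain d3 where d3: "d3 > 0" "ball p d3 \<subseteq> \<Omega>"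
      using \<Omega> p open_contains_ball by blast
    \<comment> \<open>Halving the minimum puts the ball of radius \<open>2 * s\<close> inside all
      three neighbourhoods.\<close>
    define s where "s = min d1 (min d2 d3) / 2"
    have s: "0 < s" "2 * s \<le> d1" "2 * s \<le> d2" "2 * s \<le> d3"
      using d1 d2 d3 by (auto simp: s_def)
    have sub: "ball p (2 * s) \<subseteq> \<Omega>"
      using s d3 by (meson order_trans subset_ball)
    have half: "0 < s / 2" "s / 2 < s" using s by auto
    obtain q1 where q1: "dist p q1 < 2 * s"
      "f (p + (s/2) *\<^sub>R axis i 1 + (s/2) *\<^sub>R axis j 1) - f (p + (s/2) *\<^sub>R axis i 1)
        - f (p + (s/2) *\<^sub>R axis j 1) + f p = (s/2)\<^sup>2 * pd j (pd i f) q1"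
      by (rule second_difference_mean_value[OF sub s(1) \<Omega> f half])
    obtain q2 where q2: "dist p q2 < 2 * s"
      "f (p + (s/2) *\<^sub>R axis j 1 + (s/2) *\<^sub>R axis i 1) - f (p + (s/2) *\<^sub>R axis j 1)
        - f (p + (s/2) *\<^sub>R axis i 1) + f p = (s/2)\<^sup>2 * pd i (pd j f) q2"
      by (rule second_difference_mean_value[OF sub s(1) \<Omega> f half])
    have comm: "p + (s/2) *\<^sub>R axis j 1 + (s/2) *\<^sub>R axis i 1
        = p + (s/2) *\<^sub>R axis i 1 + (s/2) *\<^sub>R axis j 1"
      by (simp add: ac_simps)
    have "(s/2)\<^sup>2 * pd j (pd i f) q1 = (s/2)\<^sup>2 * pd i (pd j f) q2"
      unfolding q1(2)[symmetric] q2(2)[symmetric] comm by simp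
    then have "pd j (pd i f) q1 = pd i (pd j f) q2" using s by simp
    moreover have "\<bar>pd i (pd j f) q2 - pd i (pd j f) p\<bar> < e / 2"
      using d1(2)[of q2] q2 s by (simp add: dist_real_def dist_commute)
    moreover have "\<bar>pd j (pd i f) q1 - pd j (pd i f) p\<bar> < e / 2"
      using d2(2)[of q1] q1 s by (simp add: dist_real_def dist_commute)
    ultimately show ?thesis by linarith
  qed
  then have "pd i (pd j f) p - pd j (pd i f) p = 0"
    by (intro dense_eq0_I less_imp_le)
  then show ?thesis by simp
qed

section \<open>Linearization of the system\<close>

lemma pd_perturb:
  assumes "smooth_on \<Omega> f" "smooth_on \<Omega> g" "open \<Omega>" "p \<in> \<Omega>"
  shows "pd i (\<lambda>q. f q + \<epsilon> * g q) p = pd i f p + \<epsilon> * pd i g p"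
  using pd_lin[OF smooth_on_differentiable[OF assms(1,3,4)] smooth_on_differentiable[OF assms(2-4)],
      of i 1 \<epsilon>] by simp

lemma pd_pd_perturb:
  assumes "smooth_on \<Omega> f" "smooth_on \<Omega> g" "open \<Omega>" "p \<in> \<Omega>"
  shows "pd j (pd i (\<lambda>q. f q + \<epsilon> * g q)) p = pd j (pd i f) p + \<epsilon> * pd j (pd i g) p"
proof -
  have "pd j (pd i (\<lambda>q. f q + \<epsilon> * g q)) p = pd j (\<lambda>q. pd i f q + \<epsilon> * pd i g q) p"
    by (rule pd_cong[OF assms(3,4)]) (simp add: pd_perturb[OF assms(1-3)])
  also have "\<dots> = pd j (pd i f) p + \<epsilon> * pd j (pd i g) p"
    by (rule pd_perturb[OF smooth_on_pd smooth_on_pd]) (use assms in auto)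
  finally show ?thesis .
qed

text \<open>The equation is affine in the pair, so its derivative in \<epsilon> is
  \<open>Dt \<phi> - \<psi>\<close>; uniqueness of derivatives gives the forward direction.\<close>

lemma satisfies_linearization_heavenly1:
  assumes "open \<Omega>" "smooth_on \<Omega> u" "smooth_on \<Omega> \<phi>"
  shows "satisfies_linearization \<Omega> heavenly1 u v \<phi> \<psi> \<longleftrightarrow> (\<forall>p\<in>\<Omega>. Dt \<phi> p = \<psi> p)"
proof -
  have "((\<lambda>\<epsilon>. heavenly1 (\<lambda>q. u q + \<epsilon> * \<phi> q) (\<lambda>q. v q + \<epsilon> * \<psi> q) p)
      has_real_derivative Dt \<phi> p - \<psi> p) (at 0)" if "p \<in> \<Omega>" for p
    unfolding heavenly1_def pd_perturb[OF assms(2,3,1) that]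
    by (auto intro!: derivative_eq_intros)
  then show ?thesis
    unfolding satisfies_linearization_def using DERIV_unique by fastforce
qed

text \<open>\<open>lin\<close> is the linearization of the second equation multiplied by
  \<open>Dz (Dy u)\<close>. On a solution it implies the linearization of the quotient form.\<close>

lemma satisfies_linearization_heavenly2I:
  assumes \<Omega>: "open \<Omega>"
    and smooth: "smooth_on \<Omega> u" "smooth_on \<Omega> v" "smooth_on \<Omega> \<phi>" "smooth_on \<Omega> \<psi>"
    and sol: "heavenly_solution \<Omega> b u v"
    and lin: "\<And>p. p \<in> \<Omega> \<Longrightarrow> Dz (Dy u) p * Dt \<psi> p + Dt v p * Dz (Dy \<phi>) p =
      Dx (Dx \<phi>) p * Dz (Dy u) p + Dx (Dx u) p * Dz (Dy \<phi>) p
      - Dy (Dx \<phi>) p * Dz (Dx u) p - Dy (Dx u) p * Dz (Dx \<phi>) p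
      + Dy \<psi> p * Dz v p + Dy v p * Dz \<psi> p
      + b * (Dy \<psi> p * Dz (Dx u) p + Dy v p * Dz (Dx \<phi>) p
             - Dz \<psi> p * Dy (Dx u) p - Dz v p * Dy (Dx \<phi>) p)"
  shows "satisfies_linearization \<Omega> (heavenly2 b) u v \<phi> \<psi>"
  unfolding satisfies_linearization_def
proof
  fix p assume p: "p \<in> \<Omega>"
  define n where "n = Dz (Dy u) p"
  define N where "N = Dx (Dx u) p * n - Dy (Dx u) p * Dz (Dx u) p + Dy v p * Dz v p
       + b * (Dy v p * Dz (Dx u) p - Dz v p * Dy (Dx u) p)"
  define M where "M = n * Dt \<psi> p + Dt v p * Dz (Dy \<phi>) p"
  have n: "n \<noteq> 0" and vt: "Dt v p = 1 / n * N"
    using sol p by (simp_all add: heavenly_solution_def heavenly2_def N_def n_def)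
  \<comment> \<open>The product rule yields the right-hand side of \<open>lin\<close>, which
    \<open>lin\<close> identifies with \<open>M\<close>.\<close>
  have num: "((\<lambda>\<epsilon>.
      (Dx (Dx u) p + \<epsilon> * Dx (Dx \<phi>) p) * (n + \<epsilon> * Dz (Dy \<phi>) p)
      - (Dy (Dx u) p + \<epsilon> * Dy (Dx \<phi>) p) * (Dz (Dx u) p + \<epsilon> * Dz (Dx \<phi>) p)
      + (Dy v p + \<epsilon> * Dy \<psi> p) * (Dz v p + \<epsilon> * Dz \<psi> p)
      + b * ((Dy v p + \<epsilon> * Dy \<psi> p) * (Dz (Dx u) p + \<epsilon> * Dz (Dx \<phi>) p)
             - (Dz v p + \<epsilon> * Dz \<psi> p) * (Dy (Dx u) p + \<epsilon> * Dy (Dx \<phi>) p)))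
      has_real_derivative M) (at 0)"
    unfolding M_def n_def lin[OF p]
    by (rule derivative_eq_intros refl)+ (simp add: algebra_simps)
  have recip: "((\<lambda>\<epsilon>. 1 / (n + \<epsilon> * Dz (Dy \<phi>) p)) has_real_derivative - Dz (Dy \<phi>) p / (n * n)) (at 0)"
    using n by (auto intro!: derivative_eq_intros)
  have "((\<lambda>\<epsilon>. Dt v p + \<epsilon> * Dt \<psi> p) has_real_derivative Dt \<psi> p) (at 0)"
    by (auto intro!: derivative_eq_intros)
  note deriv = DERIV_diff[OF this DERIV_mult[OF recip num]]
  \<comment> \<open>As \<open>N / n\<close> is \<open>Dt v p\<close>, the derivative of the
    reciprocal contributes \<open>Dt v p * Dz (Dy \<phi>) p / n\<close>, which cancels the second
    summand of \<open>M / n\<close>.\<close>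
  have value_zero: "Dt \<psi> p - (- Dz (Dy \<phi>) p / (n * n) * N + M * (1 / n)) = 0"
    using n by (simp add: M_def vt add_divide_distrib distrib_right)
  show "((\<lambda>\<epsilon>. heavenly2 b (\<lambda>q. u q + \<epsilon> * \<phi> q) (\<lambda>q. v q + \<epsilon> * \<psi> q) p)
      has_real_derivative 0) (at 0)"
    unfolding heavenly2_def pd_perturb[OF smooth(1,3) \<Omega> p] pd_perturb[OF smooth(2,4) \<Omega> p]
      pd_pd_perturb[OF smooth(1,3) \<Omega> p] n_def[symmetric]
    by (rule DERIV_cong[OF deriv]) (use value_zero in \<open>simp add: N_def\<close>)
qed

section \<open>The recursion preserves symmetries\<close>

lemma pd_commute_inner:
  assumes "smooth_on \<Omega> f" "open \<Omega>" "p \<in> \<Omega>"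
  shows "pd i (pd j (pd k f)) p = pd i (pd k (pd j f)) p"
  by (rule pd_cong[OF assms(2,3)]) (simp add: pd_commute[OF assms(1,2), of _ j k])

text \<open>Serves to replace t-derivatives: from u_t = v, \<phi>_t = \<psi> and their analogues it
  gives the t-derivatives of further partial derivatives.\<close>

lemma pd_commute_derivative:
  assumes "smooth_on \<Omega> f" "open \<Omega>" "p \<in> \<Omega>" and g: "\<And>q. q \<in> \<Omega> \<Longrightarrow> pd i f q = g q"
  shows "pd i (pd j f) p = pd j g p"
  using pd_commute[OF assms(1-3), of i j] pd_cong[OF assms(2,3), of "pd i f" g j] g by simp

text \<open>
  Here \<open>n = u\<^sub>y\<^sub>z\<close>, \<open>p = u\<^sub>x\<^sub>z\<close>, \<open>q = u\<^sub>x\<^sub>y\<close>, \<open>r = u\<^sub>x\<^sub>x\<close>, \<open>f = \<phi>'\<close>, \<open>g = \<psi>'\<close>, \<open>h = \<phi>\<close>, \<open>h_t = \<psi>\<close>,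
  and equal third derivatives carry one name: \<open>n_x = q_z\<close>, \<open>p_x = r_z\<close>, \<open>n_t = vyz\<close>.
\<close>

lemma linearized_identity:
  fixes n :: real
  assumes n: "n \<noteq> 0"
    and F: "n * vt = r * n - q * p + vy * vz + b * (vy * p - vz * q)"
    and Fz: "n_z * vt + n * vtz = p_x * n + r * n_z - n_x * p - q * p_z + vyz * vz + vy * vzz
        + b * (vyz * p + vy * p_z - vzz * q - vz * n_x)"
    and G1: "n * fx - p * fy + b * (n * g - vz * fy) = k * (n * h_t - vy * hz)"
    and G1x: "n_x * fx + n * fxx - p_x * fy - p * fxy + b * (n_x * g + n * gx - vxz * fy - vz * fxy)
        = k * (n_x * h_t + n * h_tx - vxy * hz - vy * hxz)"
    and G1z: "n_z * fx + n * fxz - p_z * fy - p * fyz + b * (n_z * g + n * gz - vzz * fy - vz * fyz)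
        = k * (n_z * h_t + n * h_tz - vyz * hz - vy * hzz)"
    and G2: "n * g - vz * fy + b * (n * fx - p * fy) = k * (n * hx - q * hz)"
    and G2t: "vyz * g + n * gt - vtz * fy - vz * gy + b * (vyz * fx + n * gx - vxz * fy - p * gy)
        = k * (vyz * hx + n * h_tx - vxy * hz - q * h_tz)"
    and G2z: "n_z * g + n * gz - vzz * fy - vz * fyz + b * (n_z * fx + n * fxz - p_z * fy - p * fyz)
        = k * (n_z * hx + n * hxz - n_x * hz - q * hzz)"
  shows "n * gt + vt * fyz = fxx * n + r * fyz - fxy * p - q * fxz + gy * vz + vy * gz
      + b * (gy * p + vy * fxz - gz * q - vz * fxy)"
proof -
  \<comment> \<open>In the notation of the header: \<open>u\<^sub>y\<^sub>z (B G2 - \<zeta> G1) - (B u\<^sub>y\<^sub>z) G2 + (\<zeta> u\<^sub>y\<^sub>z) G1\<close> plus multiples of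
    \<open>Fz\<close> and \<open>F\<close>.\<close>
  have combination: "n * n * (n * gt + vt * fyz - (fxx * n + r * fyz - fxy * p - q * fxz + gy * vz + vy * gz
      + b * (gy * p + vy * fxz - gz * q - vz * fxy)))
    = n * n * ((vyz * g + n * gt - vtz * fy - vz * gy + b * (vyz * fx + n * gx - vxz * fy - p * gy))
          - k * (vyz * hx + n * h_tx - vxy * hz - q * h_tz))
    - n * vy * ((n_z * g + n * gz - vzz * fy - vz * fyz + b * (n_z * fx + n * fxz - p_z * fy - p * fyz))
          - k * (n_z * hx + n * hxz - n_x * hz - q * hzz))
    - n * n * ((n_x * fx + n * fxx - p_x * fy - p * fxy + b * (n_x * g + n * gx - vxz * fy - vz * fxy))
          - k * (n_x * h_t + n * h_tx - vxy * hz - vy * hxz))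
    + n * q * ((n_z * fx + n * fxz - p_z * fy - p * fyz + b * (n_z * g + n * gz - vzz * fy - vz * fyz))
          - k * (n_z * h_t + n * h_tz - vyz * hz - vy * hzz))
    - (n * vyz - vy * n_z) * ((n * g - vz * fy + b * (n * fx - p * fy)) - k * (n * hx - q * hz))
    + (n * n_x - q * n_z) * ((n * fx - p * fy + b * (n * g - vz * fy)) - k * (n * h_t - vy * hz))
    + n * fy * ((n_z * vt + n * vtz) - (p_x * n + r * n_z - n_x * p - q * p_z + vyz * vz + vy * vzz
        + b * (vyz * p + vy * p_z - vzz * q - vz * n_x)))
    + (n * fyz - n_z * fy) * (n * vt - (r * n - q * p + vy * vz + b * (vy * p - vz * q)))"
    by algebra
  \<comment> \<open>By the hypotheses every bracket on the right of \<open>combination\<close>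
    vanishes, and the factor \<open>n * n\<close> cancels.\<close>
  show ?thesis
    using combination n unfolding F Fz G1 G1x G1z G2 G2t G2z by simp
qed

theorem mainTheorem4:
  fixes \<alpha> \<beta> \<gamma> b :: real and \<Omega> :: "(real ^ 4) set"
    and u v \<phi> \<psi> \<phi>' \<psi>' :: "real ^ 4 \<Rightarrow> real"
  assumes "\<alpha> + \<beta> + \<gamma> = 0" and "\<alpha> * \<beta> * \<gamma> \<noteq> 0" and "b = (\<beta> - \<gamma>) / \<alpha>"
    and "open \<Omega>"
    and "smooth_on \<Omega> u" and "smooth_on \<Omega> v"
    and "heavenly_solution \<Omega> b u v"
    and "smooth_on \<Omega> \<phi>" and "smooth_on \<Omega> \<psi>"
    and "symmetry_characteristic \<Omega> b u v \<phi> \<psi>"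
    and "smooth_on \<Omega> \<phi>'" and "smooth_on \<Omega> \<psi>'"
    and "recursion_image \<Omega> b u v \<phi> \<psi> \<phi>' \<psi>'"
    and "\<forall>p\<in>\<Omega>. Dt \<phi>' p = \<psi>' p"
  shows "symmetry_characteristic \<Omega> b u v \<phi>' \<psi>'"
proof -
  note \<Omega> = \<open>open \<Omega>\<close>
  note smooth = \<open>smooth_on \<Omega> u\<close> \<open>smooth_on \<Omega> v\<close> \<open>smooth_on \<Omega> \<phi>\<close> \<open>smooth_on \<Omega> \<psi>\<close>
    \<open>smooth_on \<Omega> \<phi>'\<close> \<open>smooth_on \<Omega> \<psi>'\<close>
  have \<phi>_t: "Dt \<phi> q = \<psi> q" if "q \<in> \<Omega>" for q
    using assms(10) that satisfies_linearization_heavenly1[OF \<Omega> smooth(1,3)]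
    by (simp add: symmetry_characteristic_def)
  have \<phi>'_t: "Dt \<phi>' q = \<psi>' q" if "q \<in> \<Omega>" for q
    using assms(14) that by simp
  have u_t: "Dt u q = v q" if "q \<in> \<Omega>" for q
    using assms(7) that by (simp add: heavenly_solution_def heavenly1_def)
  have nz: "Dz (Dy u) q \<noteq> 0" if "q \<in> \<Omega>" for q
    using assms(7) that by (simp add: heavenly_solution_def)
  \<comment> \<open>Cleared of the quotient and stated on all of \<Omega>, like \<open>G1\<close>
    and \<open>G2\<close> below, so that \<open>pd_cong\<close> can differentiate it.\<close>
  have F: "\<forall>q\<in>\<Omega>. Dz (Dy u) q * Dt v q = Dx (Dx u) q * Dz (Dy u) q - Dy (Dx u) q * Dz (Dx u) q
      + Dy v q * Dz v q + b * (Dy v q * Dz (Dx u) q - Dz v q * Dy (Dx u) q)"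
    using assms(7) by (simp add: heavenly_solution_def heavenly2_def)
  define k where "k = b * b - 1"
  have rec: "Dz (Dy u) q * Dx \<phi>' q - Dz (Dx u) q * Dy \<phi>' q
        = b * (Dz (Dy u) q * Dx \<phi> q - Dy (Dx u) q * Dz \<phi> q) + Dy v q * Dz \<phi> q - Dz (Dy u) q * \<psi> q"
      "Dz (Dy u) q * \<psi>' q = Dz v q * Dy \<phi>' q - (Dz (Dy u) q * Dx \<phi> q - Dy (Dx u) q * Dz \<phi> q)
        - b * Dy v q * Dz \<phi> q + b * Dz (Dy u) q * \<psi> q" if "q \<in> \<Omega>" for q
    using assms(13) that by (simp_all add: recursion_image_def w_op_def zeta_op_def)
  \<comment> \<open>The first row of the recursion plus \<open>b\<close> times the second; the terms
    in \<open>b * zeta_op u \<phi>\<close> cancel. \<open>G2\<close> exchanges the roles of the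
    rows.\<close>
  have G1: "\<forall>q\<in>\<Omega>. Dz (Dy u) q * Dx \<phi>' q - Dz (Dx u) q * Dy \<phi>' q
      + b * (Dz (Dy u) q * \<psi>' q - Dz v q * Dy \<phi>' q)
      = k * (Dz (Dy u) q * \<psi> q - Dy v q * Dz \<phi> q)"
    by (rule ballI, simp only: rec) (simp add: k_def algebra_simps)
  have G2: "\<forall>q\<in>\<Omega>. Dz (Dy u) q * \<psi>' q - Dz v q * Dy \<phi>' q
      + b * (Dz (Dy u) q * Dx \<phi>' q - Dz (Dx u) q * Dy \<phi>' q)
      = k * (Dz (Dy u) q * Dx \<phi> q - Dy (Dx u) q * Dz \<phi> q)"
    by (rule ballI, simp only: rec) (simp add: k_def algebra_simps)
  have "Dz (Dy u) p * Dt \<psi>' p + Dt v p * Dz (Dy \<phi>') p =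
      Dx (Dx \<phi>') p * Dz (Dy u) p + Dx (Dx u) p * Dz (Dy \<phi>') p
      - Dy (Dx \<phi>') p * Dz (Dx u) p - Dy (Dx u) p * Dz (Dx \<phi>') p
      + Dy \<psi>' p * Dz v p + Dy v p * Dz \<psi>' p
      + b * (Dy \<psi>' p * Dz (Dx u) p + Dy v p * Dz (Dx \<phi>') p
             - Dz \<psi>' p * Dy (Dx u) p - Dz v p * Dy (Dx \<phi>') p)" if p: "p \<in> \<Omega>" for p
  proof -
    have diff: "f differentiable at p" if "smooth_on \<Omega> f" for f
      using that \<Omega> p by (rule smooth_on_differentiable)
    note expand = pd_add pd_diff pd_mult pd_const diff smooth smooth_on_pd
      differentiable_add differentiable_diff differentiable_mult
    \<comment> \<open>The jet facts bring equal mixed derivatives to the single form that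
      \<open>linearized_identity\<close> expects.\<close>
    have u_jet: "Dt (Dz (Dy u)) p = Dz (Dy v) p" "Dt (Dz (Dx u)) p = Dz (Dx v) p"
      "Dt (Dy (Dx u)) p = Dy (Dx v) p"
      "Dz (Dy (Dx u)) p = Dx (Dz (Dy u)) p" "Dx (Dz (Dx u)) p = Dz (Dx (Dx u)) p"
    proof -
      have t: "Dt (pd i u) q = pd i v q" if "q \<in> \<Omega>" for i q
        by (rule pd_commute_derivative[OF smooth(1) \<Omega> that u_t])
      show "Dt (Dz (Dy u)) p = Dz (Dy v) p" "Dt (Dz (Dx u)) p = Dz (Dx v) p"
        "Dt (Dy (Dx u)) p = Dy (Dx v) p"
        by (rule pd_commute_derivative[OF smooth_on_pd[OF smooth(1)] \<Omega> p t], assumption)+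
      show "Dz (Dy (Dx u)) p = Dx (Dz (Dy u)) p"
        using pd_commute_inner[OF smooth(1) \<Omega> p, of 4 3 2]
          pd_commute[OF smooth_on_pd[OF smooth(1)] \<Omega> p, of 4 2 3] by simp
      show "Dx (Dz (Dx u)) p = Dz (Dx (Dx u)) p"
        by (rule pd_commute[OF smooth_on_pd[OF smooth(1)] \<Omega> p])
    qed
    have v_jet: "Dx (Dy v) p = Dy (Dx v) p" "Dx (Dz v) p = Dz (Dx v) p" "Dt (Dz v) p = Dz (Dt v) p"
      by (rule pd_commute[OF smooth(2) \<Omega> p])+
    have \<phi>_jet: "Dt (Dx \<phi>) p = Dx \<psi> p" "Dt (Dz \<phi>) p = Dz \<psi> p" "Dx (Dz \<phi>) p = Dz (Dx \<phi>) p"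
      by (rule pd_commute_derivative[OF smooth(3) \<Omega> p \<phi>_t] pd_commute[OF smooth(3) \<Omega> p], assumption?)+
    have \<phi>'_jet: "Dt (Dx \<phi>') p = Dx \<psi>' p" "Dt (Dy \<phi>') p = Dy \<psi>' p" "Dx (Dy \<phi>') p = Dy (Dx \<phi>') p"
      by (rule pd_commute_derivative[OF smooth(5) \<Omega> p \<phi>'_t] pd_commute[OF smooth(5) \<Omega> p], assumption?)+
    note jets = u_jet v_jet \<phi>_jet \<phi>'_jet
    note dF = pd_cong[OF \<Omega> p F] and dG1 = pd_cong[OF \<Omega> p G1] and dG2 = pd_cong[OF \<Omega> p G2]
    show ?thesis
    \<comment> \<open>The open premises are the z-derivative of \<open>F\<close>, the x- and
      z-derivatives of \<open>G1\<close> (the directions in \<zeta>), and the t- and z-derivatives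
      of \<open>G2\<close> (the directions in B).\<close>
    proof (rule linearized_identity[OF nz[OF p] bspec[OF F p] _ bspec[OF G1 p] _ _ bspec[OF G2 p]])
      show "Dz (Dz (Dy u)) p * Dt v p + Dz (Dy u) p * Dz (Dt v) p
        = Dz (Dx (Dx u)) p * Dz (Dy u) p + Dx (Dx u) p * Dz (Dz (Dy u)) p
          - Dx (Dz (Dy u)) p * Dz (Dx u) p - Dy (Dx u) p * Dz (Dz (Dx u)) p
          + Dz (Dy v) p * Dz v p + Dy v p * Dz (Dz v) p
          + b * (Dz (Dy v) p * Dz (Dx u) p + Dy v p * Dz (Dz (Dx u)) p
                 - Dz (Dz v) p * Dy (Dx u) p - Dz v p * Dx (Dz (Dy u)) p)"
        using dF[where i = 4] by (simp add: expand jets algebra_simps)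
      show "Dx (Dz (Dy u)) p * Dx \<phi>' p + Dz (Dy u) p * Dx (Dx \<phi>') p
          - Dz (Dx (Dx u)) p * Dy \<phi>' p - Dz (Dx u) p * Dy (Dx \<phi>') p
          + b * (Dx (Dz (Dy u)) p * \<psi>' p + Dz (Dy u) p * Dx \<psi>' p
                 - Dz (Dx v) p * Dy \<phi>' p - Dz v p * Dy (Dx \<phi>') p)
        = k * (Dx (Dz (Dy u)) p * \<psi> p + Dz (Dy u) p * Dx \<psi> p
               - Dy (Dx v) p * Dz \<phi> p - Dy v p * Dz (Dx \<phi>) p)"
        using dG1[where i = 2] by (simp add: expand jets algebra_simps)
      show "Dz (Dz (Dy u)) p * Dx \<phi>' p + Dz (Dy u) p * Dz (Dx \<phi>') p
          - Dz (Dz (Dx u)) p * Dy \<phi>' p - Dz (Dx u) p * Dz (Dy \<phi>') p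
          + b * (Dz (Dz (Dy u)) p * \<psi>' p + Dz (Dy u) p * Dz \<psi>' p
                 - Dz (Dz v) p * Dy \<phi>' p - Dz v p * Dz (Dy \<phi>') p)
        = k * (Dz (Dz (Dy u)) p * \<psi> p + Dz (Dy u) p * Dz \<psi> p
               - Dz (Dy v) p * Dz \<phi> p - Dy v p * Dz (Dz \<phi>) p)"
        using dG1[where i = 4] by (simp add: expand jets algebra_simps)
      show "Dz (Dy v) p * \<psi>' p + Dz (Dy u) p * Dt \<psi>' p
          - Dz (Dt v) p * Dy \<phi>' p - Dz v p * Dy \<psi>' p
          + b * (Dz (Dy v) p * Dx \<phi>' p + Dz (Dy u) p * Dx \<psi>' p
                 - Dz (Dx v) p * Dy \<phi>' p - Dz (Dx u) p * Dy \<psi>' p)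
        = k * (Dz (Dy v) p * Dx \<phi> p + Dz (Dy u) p * Dx \<psi> p
               - Dy (Dx v) p * Dz \<phi> p - Dy (Dx u) p * Dz \<psi> p)"
        using dG2[where i = 1] by (simp add: expand jets algebra_simps)
      show "Dz (Dz (Dy u)) p * \<psi>' p + Dz (Dy u) p * Dz \<psi>' p
          - Dz (Dz v) p * Dy \<phi>' p - Dz v p * Dz (Dy \<phi>') p
          + b * (Dz (Dz (Dy u)) p * Dx \<phi>' p + Dz (Dy u) p * Dz (Dx \<phi>') p
                 - Dz (Dz (Dx u)) p * Dy \<phi>' p - Dz (Dx u) p * Dz (Dy \<phi>') p)
        = k * (Dz (Dz (Dy u)) p * Dx \<phi> p + Dz (Dy u) p * Dz (Dx \<phi>) p
               - Dx (Dz (Dy u)) p * Dz \<phi> p - Dy (Dx u) p * Dz (Dz \<phi>) p)"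
        using dG2[where i = 4] by (simp add: expand jets algebra_simps)
    qed
  qed
  then have "satisfies_linearization \<Omega> (heavenly2 b) u v \<phi>' \<psi>'"
    by (rule satisfies_linearization_heavenly2I[OF \<Omega> smooth(1,2,5,6) assms(7)])
  with \<phi>'_t satisfies_linearization_heavenly1[OF \<Omega> smooth(1,5)] show ?thesis
    by (simp add: symmetry_characteristic_def)
qed

end
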